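(* Let $(I,\tilde g,V,\lambda,\mu)$ be an almost $\eta$-Ricci soliton with $V=\frac{\partial}{\partial x^3}$. Suppose that $f_1=f_1(x^2)$ depends only on $x^2$, $f_2=f_2(x^3)$ depends only on $x^3$, that the components of $\eta=\sum_{k=1}^3\eta^ke_k$ are all equal, $\eta^1=\eta^2=\eta^3=:f$, and that $\mu$ is nowhere zero on $I$. Then $\eta=0$ and $\lambda=0$. Moreover, $V$ is a Killing vector field, $f_2$ is constant, and either $f_1$ is constant or $f_1(x^2)=\frac{c_1}{x^2-c_2}$, where $c_1\in\mathbb R\setminus\{0\}$, $c_2\in\mathbb R\setminus I_2$.
   Context: Let $I=I_1\times I_2\times I_3\subseteq\mathbb R^3$ with $I_1,I_2,I_3\subseteq\mathbb R$ open intervals and standard coordinates $x^1,x^2,x^3$. Let $f_1,f_2$ be smooth nowhere zero functions on $I$ and endow $I$ with the Riemannian metric $\tilde g=\frac{1}{f_1^2}dx^1\otimes dx^1+\frac{1}{f_2^2}dx^2\otimes dx^2+dx^3\otimes dx^3$. Let $E_1=f_1\frac{\partial}{\partial x^1}$, $E_2=f_2\frac{\partial}{\partial x^2}$, $E_3=\frac{\partial}{\partial x^3}$ (an orthonormal frame), and let $e_1,e_2,e_3$ be the dual $1$-forms. For a smooth vector field $V$, a $1$-form $\eta$, and smooth functions $\lambda,\mu$ on $I$ with $\mu\neq0$, $(I,\tilde g,V,\lambda,\mu)$ is an almost $\eta$-Ricci soliton if $\frac12\pounds_V\tilde g+\mathrm{Ric}+\lambda\tilde g+\mu\,\eta\otimes\eta=0$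 on $I$, where $\pounds_V\tilde g$ is the Lie derivative of $\tilde g$ along $V$ and $\mathrm{Ric}$ is the Ricci tensor of $\tilde g$, with $\mathrm{Ric}(Y,Z)=\sum_{k}\tilde g(R(E_k,Y)Z,E_k)$, $R(X,Y)Z=\nabla_X\nabla_YZ-\nabla_Y\nabla_XZ-\nabla_{[X,Y]}Z$, $\nabla$ the Levi-Civita connection. $V$ is Killing if $\pounds_V\tilde g=0$. *)

theory Defs
  imports "HOL-Analysis.Analysis"
begin

section \<open>Smooth maps on an open set\<close>

primrec ck_on :: "nat \<Rightarrow> 'a set \<Rightarrow> ('a::real_normed_vector \<Rightarrow> 'b::real_normed_vector) \<Rightarrow> bool" where
  "ck_on 0 S f \<longleftrightarrow> continuous_on S f"
| "ck_on (Suc n) S f \<longleftrightarrow> (\<forall>x\<in>S. f differentiable (at x)) \<and>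
     (\<forall>v. ck_on n S (\<lambda>x. frechet_derivative f (at x) v))"

text \<open>Meant for open \<open>S\<close>, since derivatives are taken in the ambient space.\<close>

definition smooth_on :: "'a set \<Rightarrow> ('a::real_normed_vector \<Rightarrow> 'b::real_normed_vector) \<Rightarrow> bool" where
  "smooth_on S f \<longleftrightarrow> (\<forall>n. ck_on n S f)"


section \<open>Tensor calculus on an open subset of three-dimensional space\<close>

text \<open>
  Tangent spaces are identified with \<open>real^3\<close> through the coordinate fields. Functions, vector
  fields and tensors are total functions on \<open>real^3\<close> whose values off the domain \<open>S\<close> play no role.
\<close>

type_synonym scalar_field = "real^3 \<Rightarrow> real"
type_synonym vector_field = "real^3 \<Rightarrow> real^3"
type_synonym covector_field = "real^3 \<Rightarrow> real^3 \<Rightarrow> real"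
type_synonym bilinear_field = "real^3 \<Rightarrow> real^3 \<Rightarrow> real^3 \<Rightarrow> real"
type_synonym covariant_derivative = "vector_field \<Rightarrow> vector_field \<Rightarrow> vector_field"

definition coord_field :: "3 \<Rightarrow> vector_field" where
  "coord_field i p = axis i 1"

definition one_form_on :: "(real^3) set \<Rightarrow> covector_field \<Rightarrow> bool" where
  "one_form_on S \<eta> \<longleftrightarrow> (\<forall>p\<in>S. linear (\<eta> p)) \<and> (\<forall>v. smooth_on S (\<lambda>p. \<eta> p v))"

definition lie_bracket :: "vector_field \<Rightarrow> vector_field \<Rightarrow> vector_field" where
  "lie_bracket X Y p =
     frechet_derivative Y (at p) (X p) - frechet_derivative X (at p) (Y p)"

text \<open>The derivative of the function \<open>h\<close> in the direction of the vector field \<open>X\<close>.\<close>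

definition dir_deriv :: "vector_field \<Rightarrow> scalar_field \<Rightarrow> scalar_field" where
  "dir_deriv X h p = frechet_derivative h (at p) (X p)"

definition lie_derivative ::
    "vector_field \<Rightarrow> bilinear_field \<Rightarrow> vector_field \<Rightarrow> vector_field \<Rightarrow> scalar_field" where
  "lie_derivative V g Y Z p = dir_deriv V (\<lambda>q. g q (Y q) (Z q)) p
     - g p (lie_bracket V Y p) (Z p) - g p (Y p) (lie_bracket V Z p)"

definition killing_on :: "(real^3) set \<Rightarrow> bilinear_field \<Rightarrow> vector_field \<Rightarrow> bool" where
  "killing_on S g V \<longleftrightarrow> smooth_on S V \<and>
     (\<forall>Y Z. smooth_on S Y \<longrightarrow> smooth_on S Z \<longrightarrow> (\<forall>p\<in>S. lie_derivative V g Y Z p = 0))"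

definition affine_connection_on :: "(real^3) set \<Rightarrow> covariant_derivative \<Rightarrow> bool" where
  "affine_connection_on S nabla \<longleftrightarrow>
     (\<forall>X Y. smooth_on S X \<longrightarrow> smooth_on S Y \<longrightarrow> smooth_on S (nabla X Y)) \<and>
     (\<forall>X X' Y. smooth_on S X \<longrightarrow> smooth_on S X' \<longrightarrow> smooth_on S Y \<longrightarrow>
        (\<forall>p\<in>S. nabla (\<lambda>q. X q + X' q) Y p = nabla X Y p + nabla X' Y p)) \<and>
     (\<forall>h X Y. smooth_on S h \<longrightarrow> smooth_on S X \<longrightarrow> smooth_on S Y \<longrightarrow>
        (\<forall>p\<in>S. nabla (\<lambda>q. h q *\<^sub>R X q) Y p = h p *\<^sub>R nabla X Y p)) \<and>
     (\<forall>X Y Y'. smooth_on S X \<longrightarrow> smooth_on S Y \<longrightarrow> smooth_on S Y' \<longrightarrow>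
        (\<forall>p\<in>S. nabla X (\<lambda>q. Y q + Y' q) p = nabla X Y p + nabla X Y' p)) \<and>
     (\<forall>h X Y. smooth_on S h \<longrightarrow> smooth_on S X \<longrightarrow> smooth_on S Y \<longrightarrow>
        (\<forall>p\<in>S. nabla X (\<lambda>q. h q *\<^sub>R Y q) p = dir_deriv X h p *\<^sub>R Y p + h p *\<^sub>R nabla X Y p))"

definition levi_civita_on :: "(real^3) set \<Rightarrow> bilinear_field \<Rightarrow> covariant_derivative \<Rightarrow> bool" where
  "levi_civita_on S g nabla \<longleftrightarrow> affine_connection_on S nabla \<and>
     (\<forall>X Y. smooth_on S X \<longrightarrow> smooth_on S Y \<longrightarrow>
        (\<forall>p\<in>S. nabla X Y p - nabla Y X p = lie_bracket X Y p)) \<and>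
     (\<forall>X Y Z. smooth_on S X \<longrightarrow> smooth_on S Y \<longrightarrow> smooth_on S Z \<longrightarrow>
        (\<forall>p\<in>S. dir_deriv X (\<lambda>q. g q (Y q) (Z q)) p =
                 g p (nabla X Y p) (Z p) + g p (Y p) (nabla X Z p)))"

definition curvature ::
    "covariant_derivative \<Rightarrow> vector_field \<Rightarrow> vector_field \<Rightarrow> vector_field \<Rightarrow> vector_field" where
  "curvature nabla X Y Z p =
     nabla X (nabla Y Z) p - nabla Y (nabla X Z) p - nabla (lie_bracket X Y) Z p"

text \<open>\<open>E\<close> is meant to be a \<open>g\<close>-orthonormal frame and \<open>nabla\<close> the Levi-Civita connection of \<open>g\<close>.\<close>

definition ricci ::
    "bilinear_field \<Rightarrow> covariant_derivative \<Rightarrow> (3 \<Rightarrow> vector_field) \<Rightarrow>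
     vector_field \<Rightarrow> vector_field \<Rightarrow> scalar_field" where
  "ricci g nabla E Y Z p = (\<Sum>k\<in>UNIV. g p (curvature nabla (E k) Y Z p) (E k p))"

definition almost_eta_ricci_soliton ::
    "(real^3) set \<Rightarrow> bilinear_field \<Rightarrow> covariant_derivative \<Rightarrow> (3 \<Rightarrow> vector_field) \<Rightarrow>
     vector_field \<Rightarrow> covector_field \<Rightarrow> scalar_field \<Rightarrow> scalar_field \<Rightarrow> bool" where
  "almost_eta_ricci_soliton S g nabla E V \<eta> lam mu \<longleftrightarrow>
     smooth_on S V \<and> one_form_on S \<eta> \<and> smooth_on S lam \<and> smooth_on S mu \<and>
     (\<exists>p\<in>S. mu p \<noteq> 0) \<and>
     (\<forall>Y Z. smooth_on S Y \<longrightarrow> smooth_on S Z \<longrightarrow>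
        (\<forall>p\<in>S. (1/2) * lie_derivative V g Y Z p + ricci g nabla E Y Z p
           + lam p * g p (Y p) (Z p) + mu p * (\<eta> p (Y p) * \<eta> p (Z p)) = 0))"


section \<open>The diagonal metric\<close>

definition open_interval :: "real set \<Rightarrow> bool" where
  "open_interval J \<longleftrightarrow> open J \<and> is_interval J \<and> J \<noteq> {}"

definition box3 :: "real set \<Rightarrow> real set \<Rightarrow> real set \<Rightarrow> (real^3) set" where
  "box3 I1 I2 I3 = {p. p $ 1 \<in> I1 \<and> p $ 2 \<in> I2 \<and> p $ 3 \<in> I3}"

definition diag_metric :: "scalar_field \<Rightarrow> scalar_field \<Rightarrow> bilinear_field" where
  "diag_metric f1 f2 p v w =
     1 / (f1 p)\<^sup>2 * (v $ 1 * w $ 1) + 1 / (f2 p)\<^sup>2 * (v $ 2 * w $ 2) + v $ 3 * w $ 3"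

definition diag_frame :: "scalar_field \<Rightarrow> scalar_field \<Rightarrow> 3 \<Rightarrow> vector_field" where
  "diag_frame f1 f2 k p =
     (if k = 1 then f1 p *\<^sub>R coord_field 1 p
      else if k = 2 then f2 p *\<^sub>R coord_field 2 p
      else coord_field 3 p)"

definition diag_coframe :: "scalar_field \<Rightarrow> scalar_field \<Rightarrow> 3 \<Rightarrow> covector_field" where
  "diag_coframe f1 f2 k p v =
     (if k = 1 then v $ 1 / f1 p else if k = 2 then v $ 2 / f2 p else v $ 3)"

lemma diag_frame_orthonormal:
  assumes "f1 p \<noteq> 0" "f2 p \<noteq> 0"
  shows "diag_metric f1 f2 p (diag_frame f1 f2 i p) (diag_frame f1 f2 j p) = (if i = j then 1 else 0)"
  using assms exhaust_3[of i] exhaust_3[of j]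
  by (auto simp: diag_metric_def diag_frame_def coord_field_def axis_def power2_eq_square)

lemma diag_coframe_dual:
  assumes "f1 p \<noteq> 0" "f2 p \<noteq> 0"
  shows "diag_coframe f1 f2 i p (diag_frame f1 f2 j p) = (if i = j then 1 else 0)"
  using assms exhaust_3[of i] exhaust_3[of j]
  by (auto simp: diag_coframe_def diag_frame_def coord_field_def axis_def)

definition depends_only_on_coord :: "(real^3) set \<Rightarrow> 3 \<Rightarrow> scalar_field \<Rightarrow> bool" where
  "depends_only_on_coord S i h \<longleftrightarrow> (\<forall>p\<in>S. \<forall>q\<in>S. p $ i = q $ i \<longrightarrow> h p = h q)"


section \<open>Closure properties of smooth maps\<close>

lemma has_derivative_cong_open:
  assumes "open S" "x \<in> S" "\<And>x. x \<in> S \<Longrightarrow> f x = g x"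
  shows "(f has_derivative D) (at x) \<longleftrightarrow> (g has_derivative D) (at x)"
proof
  assume "(f has_derivative D) (at x)"
  then show "(g has_derivative D) (at x)"
    by (rule has_derivative_transform_within_open[OF _ assms(1,2)]) (rule assms(3))
next
  assume "(g has_derivative D) (at x)"
  then show "(f has_derivative D) (at x)"
    by (rule has_derivative_transform_within_open[OF _ assms(1,2)]) (rule assms(3)[symmetric])
qed

lemma fd_cong:
  assumes "open S" "x \<in> S" "\<And>x. x \<in> S \<Longrightarrow> f x = g x"
  shows "frechet_derivative f (at x) = frechet_derivative g (at x)"
proof -
  have "(f has_derivative D) (at x) = (g has_derivative D) (at x)" for D
    by (rule has_derivative_cong_open[OF assms(1,2)]) (rule assms(3))
  then show ?thesis unfolding frechet_derivative_def by simp
qed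

lemma ck_cong:
  assumes "open S" "\<And>x. x \<in> S \<Longrightarrow> f x = g x" "ck_on n S f"
  shows "ck_on n S g"
  using assms(2,3)
proof (induction n arbitrary: f g)
  case 0
  then show ?case using continuous_on_cong[of S S f g] by simp
next
  case (Suc n)
  note eq = Suc.prems(1)
  have "g differentiable at x" if "x \<in> S" for x
  proof -
    have "f differentiable at x" using Suc.prems(2) that by simp
    moreover have "(f has_derivative D) (at x) = (g has_derivative D) (at x)" for D
      by (rule has_derivative_cong_open[OF assms(1) that]) (rule eq)
    ultimately show ?thesis unfolding differentiable_def by simp
  qed
  moreover have "ck_on n S (\<lambda>x. frechet_derivative g (at x) v)" for v
  proof (rule Suc.IH)
    show "ck_on n S (\<lambda>x. frechet_derivative f (at x) v)" using Suc.prems(2) by simp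
    show "frechet_derivative f (at x) v = frechet_derivative g (at x) v" if "x \<in> S" for x
      by (rule fun_cong, rule fd_cong[OF assms(1) that]) (rule eq)
  qed
  ultimately show ?case by simp
qed

lemma ck_Suc_D: "ck_on (Suc n) S f \<Longrightarrow> ck_on n S f"
proof (induction n arbitrary: f)
  case 0
  then show ?case
    by (simp add: continuous_at_imp_continuous_on differentiable_imp_continuous_within)
next
  case (Suc n)
  have "ck_on n S (\<lambda>x. frechet_derivative f (at x) v)" for v
    by (rule Suc.IH) (use Suc.prems in simp)
  then show ?case using Suc.prems by simp
qed

lemma ck_const: "ck_on n S (\<lambda>x. c)"
  by (induction n arbitrary: c) auto

lemma ck_add:
  assumes "open S"
  shows "ck_on n S f \<Longrightarrow> ck_on n S g \<Longrightarrow> ck_on n S (\<lambda>x. f x + g x)"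
proof (induction n arbitrary: f g)
  case 0
  then show ?case by (auto intro: continuous_intros)
next
  case (Suc n)
  have D: "((\<lambda>x. f x + g x) has_derivative (\<lambda>v. frechet_derivative f (at x) v
       + frechet_derivative g (at x) v)) (at x)" if "x \<in> S" for x
    using Suc.prems that
    by (intro has_derivative_add) (simp_all add: frechet_derivative_works)
  have "ck_on n S (\<lambda>x. frechet_derivative (\<lambda>x. f x + g x) (at x) v)" for v
  proof (rule ck_cong[OF assms])
    show "ck_on n S (\<lambda>x. frechet_derivative f (at x) v + frechet_derivative g (at x) v)"
      using Suc.prems by (intro Suc.IH) simp_all
    show "frechet_derivative f (at x) v + frechet_derivative g (at x) v =
        frechet_derivative (\<lambda>x. f x + g x) (at x) v" if "x \<in> S" for x
      using fun_cong[OF frechet_derivative_at[OF D[OF that]], of v] by simp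
  qed
  then show ?case using D unfolding ck_on.simps differentiable_def by blast
qed

lemma ck_bilinear:
  assumes "open S" and b: "bounded_bilinear b"
  shows "ck_on n S f \<Longrightarrow> ck_on n S g \<Longrightarrow> ck_on n S (\<lambda>x. b (f x) (g x))"
proof (induction n arbitrary: f g)
  case 0
  then show ?case using bounded_bilinear.continuous_on[OF b] by auto
next
  case (Suc n)
  have D: "((\<lambda>x. b (f x) (g x)) has_derivative (\<lambda>v. b (f x) (frechet_derivative g (at x) v)
       + b (frechet_derivative f (at x) v) (g x))) (at x)" if "x \<in> S" for x
    using Suc.prems that
    by (intro bounded_bilinear.FDERIV[OF b]) (auto simp: frechet_derivative_works)
  have "ck_on n S (\<lambda>x. frechet_derivative (\<lambda>x. b (f x) (g x)) (at x) v)" for v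
  proof (rule ck_cong[OF assms(1)])
    show "ck_on n S (\<lambda>x. b (f x) (frechet_derivative g (at x) v)
       + b (frechet_derivative f (at x) v) (g x))"
      using Suc.prems(1,2)[THEN ck_Suc_D] Suc.prems
      by (intro ck_add[OF assms(1)] Suc.IH) auto
    show "b (f x) (frechet_derivative g (at x) v) + b (frechet_derivative f (at x) v) (g x) =
        frechet_derivative (\<lambda>x. b (f x) (g x)) (at x) v" if "x \<in> S" for x
      using fun_cong[OF frechet_derivative_at[OF D[OF that]], of v] by simp
  qed
  then show ?case using D unfolding ck_on.simps differentiable_def by blast
qed

lemma ck_inverse:
  fixes f :: "'a::real_normed_vector \<Rightarrow> real"
  assumes "open S" "\<And>x. x \<in> S \<Longrightarrow> f x \<noteq> 0"
  shows "ck_on n S f \<Longrightarrow> ck_on n S (\<lambda>x. inverse (f x))"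
proof (induction n)
  case 0
  then show ?case using assms by (auto intro!: continuous_intros)
next
  case (Suc n)
  have D: "((\<lambda>x. inverse (f x)) has_derivative (\<lambda>v. - (inverse (f x) * frechet_derivative f (at x) v
       * inverse (f x)))) (at x)" if "x \<in> S" for x
    using Suc.prems that assms(2)
    by (intro Deriv.has_derivative_inverse) (auto simp: frechet_derivative_works)
  have "ck_on n S (\<lambda>x. frechet_derivative (\<lambda>x. inverse (f x)) (at x) v)" for v
  proof (rule ck_cong[OF assms(1)])
    show "ck_on n S (\<lambda>x. (- 1) * (inverse (f x) * frechet_derivative f (at x) v * inverse (f x)))"
      using Suc.prems ck_Suc_D[OF Suc.prems]
      by (intro ck_bilinear[OF assms(1) bounded_bilinear_mult] Suc.IH ck_const) auto
    show "- 1 * (inverse (f x) * frechet_derivative f (at x) v * inverse (f x)) =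
      frechet_derivative (\<lambda>x. inverse (f x)) (at x) v" if "x \<in> S" for x
      using fun_cong[OF frechet_derivative_at[OF D[OF that]], of v] by simp
  qed
  then show ?case using D unfolding ck_on.simps differentiable_def by blast
qed

lemma smooth_cong: "open S \<Longrightarrow> (\<And>x. x \<in> S \<Longrightarrow> f x = g x) \<Longrightarrow> smooth_on S f \<Longrightarrow> smooth_on S g"
  unfolding smooth_on_def by (intro allI, rule ck_cong[of S f g]) simp_all

lemma smooth_const: "smooth_on S (\<lambda>x. c)"
  unfolding smooth_on_def by (simp add: ck_const)

lemma smooth_add: "open S \<Longrightarrow> smooth_on S f \<Longrightarrow> smooth_on S g \<Longrightarrow> smooth_on S (\<lambda>x. f x + g x)"
  unfolding smooth_on_def by (simp add: ck_add)

lemma smooth_bilinear: "open S \<Longrightarrow> bounded_bilinear b \<Longrightarrow> smooth_on S f \<Longrightarrow> smooth_on S g \<Longrightarrow>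
   smooth_on S (\<lambda>x. b (f x) (g x))"
  unfolding smooth_on_def by (simp add: ck_bilinear)

lemmas smooth_mult = smooth_bilinear[OF _ bounded_bilinear_mult]
lemmas smooth_scaleR = smooth_bilinear[OF _ bounded_bilinear_scaleR]

lemma smooth_inverse: "open S \<Longrightarrow> (\<And>x. x \<in> S \<Longrightarrow> f x \<noteq> (0::real)) \<Longrightarrow> smooth_on S f \<Longrightarrow>
   smooth_on S (\<lambda>x. inverse (f x))"
  unfolding smooth_on_def by (simp add: ck_inverse)

lemma smooth_deriv:
  assumes "smooth_on S f" shows "smooth_on S (\<lambda>x. frechet_derivative f (at x) v)"
  unfolding smooth_on_def
proof
  fix n from assms have "ck_on (Suc n) S f" unfolding smooth_on_def by (rule spec)
  then show "ck_on n S (\<lambda>x. frechet_derivative f (at x) v)" by simp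
qed

lemma smooth_differentiable:
  assumes "smooth_on S f" "x \<in> S" shows "f differentiable at x"
proof -
  from assms(1) have "ck_on (Suc 0) S f" unfolding smooth_on_def by (rule spec)
  with assms(2) show ?thesis by simp
qed

lemma smooth_sum: "open S \<Longrightarrow> finite A \<Longrightarrow> (\<And>i. i \<in> A \<Longrightarrow> smooth_on S (f i)) \<Longrightarrow>
    smooth_on S (\<lambda>x. \<Sum>i\<in>A. f i x)"
  by (induction A rule: infinite_finite_induct) (auto intro: smooth_add smooth_const)

lemma smooth_inner: "open S \<Longrightarrow> smooth_on S f \<Longrightarrow> smooth_on S (\<lambda>x. f x \<bullet> c)"
  using smooth_bilinear[OF _ bounded_bilinear_inner, of S f "\<lambda>_. c"] smooth_const by auto

lemma smooth_nth:
  fixes f :: "'a::real_normed_vector \<Rightarrow> real^'n"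
  assumes "open S" "smooth_on S f" shows "smooth_on S (\<lambda>x. f x $ i)"
  using smooth_inner[OF assms, of "axis i 1"] by (simp add: inner_axis)

lemma smooth_vec:
  fixes f :: "'a::real_normed_vector \<Rightarrow> real^'n"
  assumes "open S" "\<And>i. smooth_on S (\<lambda>x. f x $ i)" shows "smooth_on S f"
proof -
  have "smooth_on S (\<lambda>x. \<Sum>i\<in>UNIV. (f x $ i) *\<^sub>R axis i (1::real))"
    using assms by (intro smooth_sum smooth_scaleR smooth_const) auto
  moreover have "(\<Sum>i\<in>UNIV. (f x $ i) *\<^sub>R axis i (1::real)) = f x" for x
    using basis_expansion[of "f x"] by (simp add: scalar_mult_eq_scaleR)
  ultimately show ?thesis by simp
qed

lemma smooth_along:
  fixes X :: "real^'n \<Rightarrow> real^'n"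
  assumes "open S" "smooth_on S f" "smooth_on S X"
  shows "smooth_on S (\<lambda>x. frechet_derivative f (at x) (X x))"
proof (rule smooth_cong[OF assms(1)])
  show "smooth_on S (\<lambda>x. \<Sum>i\<in>UNIV. (X x $ i) *\<^sub>R frechet_derivative f (at x) (axis i 1))"
    using assms by (intro smooth_sum smooth_scaleR smooth_deriv smooth_nth) auto
  fix x assume "x \<in> S"
  then have "linear (frechet_derivative f (at x))"
    using smooth_differentiable[OF assms(2)] linear_frechet_derivative by blast
  then show "(\<Sum>i\<in>UNIV. (X x $ i) *\<^sub>R frechet_derivative f (at x) (axis i 1)) =
    frechet_derivative f (at x) (X x)"
    by (subst (2) basis_expansion[symmetric])
      (simp add: scalar_mult_eq_scaleR linear_sum linear_cmul)
qed


section \<open>Existence of the Levi-Civita connection\<close>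

text \<open>It is given by the Christoffel symbols of the metric.\<close>

context
  fixes S :: "(real^3) set" and a :: "3 \<Rightarrow> scalar_field"
  assumes S: "open S" and a: "\<And>k. smooth_on S (a k)" and nz: "\<And>k p. p \<in> S \<Longrightarrow> a k p \<noteq> 0"
begin

private definition chris :: "real^3 \<Rightarrow> real^3 \<Rightarrow> real^3 \<Rightarrow> real^3" where
  "chris p v w = (\<chi> k. inverse (2 * a k p) *
     (frechet_derivative (a k) (at p) v * w $ k + frechet_derivative (a k) (at p) w * v $ k
      - (\<Sum>i\<in>UNIV. frechet_derivative (a i) (at p) (axis k 1) * v $ i * w $ i)))"

private definition conn :: covariant_derivative where
  "conn X Y p = frechet_derivative Y (at p) (X p) + chris p (X p) (Y p)"

private lemma lin: "smooth_on S f \<Longrightarrow> p \<in> S \<Longrightarrow> linear (frechet_derivative f (at p))"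
  using smooth_differentiable linear_frechet_derivative by blast

private lemma der: "smooth_on S f \<Longrightarrow> p \<in> S \<Longrightarrow> (f has_derivative frechet_derivative f (at p)) (at p)"
  using smooth_differentiable frechet_derivative_works by blast

private lemma lins:
  assumes "smooth_on S f" "p \<in> S"
  shows "frechet_derivative f (at p) (v + w) = frechet_derivative f (at p) v + frechet_derivative f (at p) w"
    "frechet_derivative f (at p) (c *\<^sub>R v) = c *\<^sub>R frechet_derivative f (at p) v"
  using linear_add[OF lin[OF assms]] linear_cmul[OF lin[OF assms]] by auto

private lemma smooth_minus: "smooth_on S f \<Longrightarrow> smooth_on S g \<Longrightarrow> smooth_on S (\<lambda>x. f x - g x :: real)"
  using smooth_add[OF S, of f "\<lambda>x. (-1) * g x"] smooth_mult[OF S, of "\<lambda>_. -1" g] smooth_const[of S "-1::real"]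
  by simp

private lemma conn_smooth:
  assumes X: "smooth_on S X" and Y: "smooth_on S Y"
  shows "smooth_on S (conn X Y)"
proof -
  have "smooth_on S (\<lambda>p. chris p (X p) (Y p))"
    unfolding chris_def
    by (rule smooth_vec[OF S], simp only: vec_lambda_beta)
      (intro smooth_mult smooth_minus smooth_add smooth_inverse smooth_sum smooth_along smooth_deriv
         smooth_nth smooth_const S X Y a, simp_all add: nz)
  then show ?thesis unfolding conn_def using smooth_along[OF S Y X] smooth_add[OF S] by blast
qed

private lemma chris_add:
  assumes "p \<in> S"
  shows "chris p (v + v') w = chris p v w + chris p v' w" "chris p v (w + w') = chris p v w + chris p v w'"
  using assms by (simp_all add: chris_def vec_eq_iff lins[OF a] algebra_simps sum.distrib)

private lemma chris_scale:
  assumes "p \<in> S"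
  shows "chris p (c *\<^sub>R v) w = c *\<^sub>R chris p v w" "chris p v (c *\<^sub>R w) = c *\<^sub>R chris p v w"
  using assms by (simp_all add: chris_def vec_eq_iff lins[OF a] algebra_simps sum_distrib_left)

private lemma chris_sym: "chris p v w = chris p w v"
  by (simp add: chris_def vec_eq_iff algebra_simps)

private lemma der_expand:
  assumes "smooth_on S f" "p \<in> S"
  shows "frechet_derivative f (at p) v = (\<Sum>i\<in>UNIV. (v $ i) *\<^sub>R frechet_derivative f (at p) (axis i 1))"
  by (subst basis_expansion[of v, symmetric])
    (simp add: scalar_mult_eq_scaleR linear_sum[OF lin[OF assms]] linear_cmul[OF lin[OF assms]])

private lemma chris_metric:
  assumes p: "p \<in> S"
  shows "(\<Sum>k\<in>UNIV. a k p * (chris p v w $ k * u $ k + w $ k * chris p v u $ k)) =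
     (\<Sum>k\<in>UNIV. frechet_derivative (a k) (at p) v * w $ k * u $ k)"
proof -
  have *: "a k p * (chris p v w $ k * x) = (frechet_derivative (a k) (at p) v * w $ k + frechet_derivative (a k) (at p) w * v $ k
      - (\<Sum>i\<in>UNIV. frechet_derivative (a i) (at p) (axis k 1) * v $ i * w $ i)) * x / 2" for k v w x
    using nz[OF p, of k] by (simp add: chris_def field_simps)
  have "a k p * (chris p v w $ k * u $ k + w $ k * chris p v u $ k) =
    a k p * (chris p v w $ k * u $ k) + a k p * (chris p v u $ k * w $ k)" for k
    by (simp add: algebra_simps)
  then show ?thesis
    unfolding *
    by (simp add: sum_3 der_expand[OF a p, where v = w] der_expand[OF a p, where v = u])
      (simp add: field_simps)
qed

private lemma levi_civita_diag:
  "levi_civita_on S (\<lambda>p v w. \<Sum>k\<in>UNIV. a k p * (v $ k * w $ k)) conn"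
  unfolding levi_civita_on_def affine_connection_on_def
proof (intro conjI allI impI ballI)
  fix X Y :: vector_field assume "smooth_on S X" "smooth_on S Y"
  then show "smooth_on S (conn X Y)" by (rule conn_smooth)
next
  fix X X' Y :: vector_field and p assume "smooth_on S Y" "p \<in> S"
  then show "conn (\<lambda>q. X q + X' q) Y p = conn X Y p + conn X' Y p"
    by (simp add: conn_def lins chris_add)
next
  fix h :: scalar_field and X Y :: vector_field and p assume "smooth_on S Y" "p \<in> S"
  then show "conn (\<lambda>q. h q *\<^sub>R X q) Y p = h p *\<^sub>R conn X Y p"
    by (simp add: conn_def lins chris_scale algebra_simps)
next
  fix X Y Y' :: vector_field and p assume *: "smooth_on S Y" "smooth_on S Y'" "p \<in> S"
  have "frechet_derivative (\<lambda>q. Y q + Y' q) (at p) =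
     (\<lambda>v. frechet_derivative Y (at p) v + frechet_derivative Y' (at p) v)"
    by (rule frechet_derivative_at[symmetric]) (intro has_derivative_add der *)
  with * show "conn X (\<lambda>q. Y q + Y' q) p = conn X Y p + conn X Y' p"
    by (simp add: conn_def chris_add)
next
  fix h :: scalar_field and X Y :: vector_field and p assume *: "smooth_on S h" "smooth_on S Y" "p \<in> S"
  have "frechet_derivative (\<lambda>q. h q *\<^sub>R Y q) (at p) =
     (\<lambda>v. h p *\<^sub>R frechet_derivative Y (at p) v + frechet_derivative h (at p) v *\<^sub>R Y p)"
    by (rule frechet_derivative_at[symmetric]) (intro has_derivative_scaleR der *)
  with * show "conn X (\<lambda>q. h q *\<^sub>R Y q) p = dir_deriv X h p *\<^sub>R Y p + h p *\<^sub>R conn X Y p"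
    by (simp add: conn_def chris_scale dir_deriv_def algebra_simps)
next
  fix X Y :: vector_field and p
  show "conn X Y p - conn Y X p = lie_bracket X Y p"
    using chris_sym[of p "X p" "Y p"] by (simp add: conn_def lie_bracket_def)
next
  fix X Y Z :: vector_field and p assume *: "smooth_on S Y" "smooth_on S Z" and p: "p \<in> S"
  let ?D = "\<lambda>f. frechet_derivative f (at p) (X p)"
  note nth = bounded_linear.has_derivative[OF bounded_linear_vec_nth]
  have "frechet_derivative (\<lambda>q. \<Sum>k\<in>UNIV. a k q * (Y q $ k * Z q $ k)) (at p) =
     (\<lambda>v. \<Sum>k\<in>UNIV. a k p * (Y p $ k * frechet_derivative Z (at p) v $ k
         + frechet_derivative Y (at p) v $ k * Z p $ k)
       + frechet_derivative (a k) (at p) v * (Y p $ k * Z p $ k))"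
    by (rule frechet_derivative_at[symmetric])
      (intro has_derivative_sum has_derivative_mult der nth * p a)
  then have "dir_deriv X (\<lambda>q. \<Sum>k\<in>UNIV. a k q * (Y q $ k * Z q $ k)) p =
    (\<Sum>k\<in>UNIV. a k p * (?D Y $ k * Z p $ k + Y p $ k * ?D Z $ k))
    + (\<Sum>k\<in>UNIV. ?D (a k) * Y p $ k * Z p $ k)"
    unfolding dir_deriv_def by (simp add: sum.distrib algebra_simps)
  also have "\<dots> = (\<Sum>k\<in>UNIV. a k p * (conn X Y p $ k * Z p $ k)) +
      (\<Sum>k\<in>UNIV. a k p * (Y p $ k * conn X Z p $ k))"
    unfolding chris_metric[OF p, symmetric] conn_def by (simp add: sum.distrib algebra_simps)
  finally show "dir_deriv X (\<lambda>q. \<Sum>k\<in>UNIV. a k q * (Y q $ k * Z q $ k)) p =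
    (\<Sum>k\<in>UNIV. a k p * (conn X Y p $ k * Z p $ k)) +
      (\<Sum>k\<in>UNIV. a k p * (Y p $ k * conn X Z p $ k))" .
qed

lemma levi_civita_diag_exists:
  "\<exists>nabla. levi_civita_on S (\<lambda>p v w. \<Sum>k\<in>UNIV. a k p * (v $ k * w $ k)) nabla"
  using levi_civita_diag by blast

end

lemma levi_civita_diag_metric_exists:
  assumes S: "open S" and f: "smooth_on S f1" "smooth_on S f2"
    and nz: "\<forall>p\<in>S. f1 p \<noteq> 0" "\<forall>p\<in>S. f2 p \<noteq> 0"
  shows "\<exists>nabla. levi_civita_on S (diag_metric f1 f2) nabla"
proof -
  define a :: "3 \<Rightarrow> scalar_field" where
    "a k p = (if k = 1 then inverse (f1 p * f1 p) else if k = 2 then inverse (f2 p * f2 p) else 1)" for k p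
  have "smooth_on S (a k)" for k
  proof -
    have "smooth_on S (\<lambda>p. inverse (f1 p * f1 p))" "smooth_on S (\<lambda>p. inverse (f2 p * f2 p))"
      by (intro smooth_inverse smooth_mult S f, simp add: nz)+
    then show ?thesis unfolding a_def using smooth_const[of S "1::real"]
      by (cases "k = 1"; cases "k = 2") simp_all
  qed
  moreover have "a k p \<noteq> 0" if "p \<in> S" for k p
    using nz that by (simp add: a_def)
  ultimately have "\<exists>nabla. levi_civita_on S (\<lambda>p v w. \<Sum>k\<in>UNIV. a k p * (v $ k * w $ k)) nabla"
    by (rule levi_civita_diag_exists[OF S])
  moreover have "diag_metric f1 f2 = (\<lambda>p v w. \<Sum>k\<in>UNIV. a k p * (v $ k * w $ k))"
    by (simp add: fun_eq_iff diag_metric_def a_def sum_3 power2_eq_square divide_inverse)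
  ultimately show ?thesis by simp
qed

end

theory Submission
  imports Defs
begin

text \<open>
  Put \<open>a = E\<^sub>2(f\<^sub>1)/f\<^sub>1\<close> and \<open>b = E\<^sub>3(f\<^sub>2)/f\<^sub>2\<close>. The brackets of the frame are \<open>[E\<^sub>1,E\<^sub>2] = -a E\<^sub>1\<close>,
  \<open>[E\<^sub>2,E\<^sub>3] = -b E\<^sub>2\<close>, \<open>[E\<^sub>1,E\<^sub>3] = 0\<close>, so the Koszul formula gives the connection and hence the
  Ricci tensor on the frame. Its (1,2) component vanishes, so the soliton equation there reads
  \<open>\<mu> f\<^sup>2 = 0\<close> and \<open>\<eta> = 0\<close>. The components (1,1), (2,2), (3,3), (2,3) then amount to \<open>\<lambda> = -b\<close>,
  \<open>E\<^sub>2(a) - a\<^sup>2 = b\<close>, \<open>E\<^sub>3(b) - b\<^sup>2 = b\<close> and \<open>a b = 0\<close>. Differentiating \<open>a b = 0\<close> along \<open>E\<^sub>2\<close> at a point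
  with \<open>b \<noteq> 0\<close> gives \<open>a = E\<^sub>2(a) = 0\<close> and so \<open>b = 0\<close>, a contradiction. Thus \<open>b = 0\<close>, and
  \<open>E\<^sub>2(a) = a\<^sup>2\<close> says that \<open>1/f\<^sub>1\<close> is an affine function of \<open>x\<^sup>2\<close>.
\<close>

section \<open>Derivatives along lines and in one variable\<close>

text \<open>The parameters t that keep \<open>p + t *\<^sub>R v\<close> inside \<open>S\<close> form
  an open set around 0, on which the restriction of \<open>h\<close> is constant. The chain rule
  computes the same derivative as \<open>D (t *\<^sub>R v)\<close>, and t = 1 gives the
  claim.\<close>

lemma frechet_derivative_constant_direction:
  fixes h :: "'a::real_normed_vector \<Rightarrow> 'b::real_normed_vector"
  assumes "open S" "p \<in> S" "h differentiable at p"
    and const: "\<And>t. p + t *\<^sub>R v \<in> S \<Longrightarrow> h (p + t *\<^sub>R v) = h p"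
  shows "frechet_derivative h (at p) v = 0"
proof -
  let ?D = "frechet_derivative h (at p)"
  let ?T = "(\<lambda>t::real. p + t *\<^sub>R v) -` S"
  have T: "open ?T"
    by (intro open_vimage \<open>open S\<close> continuous_intros)
  have "((\<lambda>t::real. p + t *\<^sub>R v) has_derivative (\<lambda>t. t *\<^sub>R v)) (at 0)"
    by (auto intro!: derivative_eq_intros)
  moreover have "(h has_derivative ?D) (at (p + 0 *\<^sub>R v))"
    using assms(3) by (simp add: frechet_derivative_works)
  ultimately have "((\<lambda>t. h (p + t *\<^sub>R v)) has_derivative (\<lambda>t. ?D (t *\<^sub>R v))) (at 0)"
    using has_derivative_compose by fastforce
  then have "((\<lambda>t. h p) has_derivative (\<lambda>t. ?D (t *\<^sub>R v))) (at (0::real))"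
    by (rule has_derivative_transform_within_open[OF _ T]) (use assms(2) const in auto)
  then have "(\<lambda>t::real. ?D (t *\<^sub>R v)) = (\<lambda>t. 0)"
    using has_derivative_unique has_derivative_const by blast
  from fun_cong[OF this, of 1] show ?thesis by simp
qed

text \<open>Removing from \<open>v\<close> its i-th component leaves a direction \<open>w\<close>
  that fixes coordinate i, so \<open>h\<close> is constant along it; linearity does the
  rest.\<close>

lemma frechet_derivative_depends_only_on_coord:
  assumes S: "open S" "p \<in> S" and h: "h differentiable at p" and dep: "depends_only_on_coord S i h"
  shows "frechet_derivative h (at p) v = v $ i * frechet_derivative h (at p) (axis i 1)"
proof -
  define w where "w = v - (v $ i) *\<^sub>R axis i 1"
  have "frechet_derivative h (at p) w = 0"
  proof (rule frechet_derivative_constant_direction[OF S h])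
    fix t assume "p + t *\<^sub>R w \<in> S"
    moreover have "(p + t *\<^sub>R w) $ i = p $ i" by (simp add: w_def)
    ultimately show "h (p + t *\<^sub>R w) = h p"
      using dep S(2) unfolding depends_only_on_coord_def by blast
  qed
  then show ?thesis
    unfolding w_def using linear_diff[OF linear_frechet_derivative[OF h]]
      linear_cmul[OF linear_frechet_derivative[OF h]] by simp
qed

text \<open>Constancy on a convex set is applied twice, first to \<open>h'\<close> and then to
  \<open>h t - c * t\<close>. It will be used for the reciprocal of \<open>f1\<close> along a
  coordinate line.\<close>

lemma affine_of_second_derivative_zero:
  fixes h h' :: "real \<Rightarrow> real"
  assumes J: "convex J"
    and h: "\<And>t. t \<in> J \<Longrightarrow> (h has_real_derivative h' t) (at t)"
    and h': "\<And>t. t \<in> J \<Longrightarrow> (h' has_real_derivative 0) (at t)"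
  obtains c d where "\<And>t. t \<in> J \<Longrightarrow> h t = c * t + d"
proof -
  have "\<exists>c. \<forall>t\<in>J. h' t = c"
    by (rule has_field_derivative_zero_constant[OF J], rule has_field_derivative_at_within, rule h')
  then obtain c where c: "\<And>t. t \<in> J \<Longrightarrow> h' t = c" by blast
  have "((\<lambda>t. h t - c * t) has_real_derivative 0) (at t within J)" if "t \<in> J" for t
  proof -
    have "((\<lambda>t. h t - c * t) has_real_derivative c - c) (at t)"
      by (intro DERIV_diff DERIV_cmult_Id) (use h[OF that] c[OF that] in simp)
    then show ?thesis by (simp add: has_field_derivative_at_within)
  qed
  from has_field_derivative_zero_constant[OF J this]
  obtain d where d: "\<And>t. t \<in> J \<Longrightarrow> h t - c * t = d" by blast
  show thesis
  proof (rule that)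
    fix t assume "t \<in> J"
    from d[OF this] show "h t = c * t + d" by linarith
  qed
qed

lemma has_derivative_along_line:
  fixes h :: "'a::real_normed_vector \<Rightarrow> real"
  assumes "h differentiable at (p + t *\<^sub>R v)"
  shows "((\<lambda>t. h (p + t *\<^sub>R v)) has_real_derivative
    frechet_derivative h (at (p + t *\<^sub>R v)) v) (at t)"
proof -
  let ?D = "frechet_derivative h (at (p + t *\<^sub>R v))"
  have "((\<lambda>t. p + t *\<^sub>R v) has_derivative (\<lambda>x. x *\<^sub>R v)) (at t)"
    by (auto intro!: derivative_eq_intros)
  from has_derivative_compose[OF this, of h ?D]
  have "((\<lambda>t. h (p + t *\<^sub>R v)) has_derivative (\<lambda>x. ?D (x *\<^sub>R v))) (at t)"
    using assms by (simp add: frechet_derivative_works)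
  moreover have "(\<lambda>x. ?D (x *\<^sub>R v)) = (*) (?D v)"
    using linear_cmul[OF linear_frechet_derivative[OF assms]] by (simp add: fun_eq_iff mult.commute)
  ultimately show ?thesis by (simp add: has_field_derivative_def)
qed

section \<open>Koszul formula and algebra of the diagonal metric\<close>

text \<open>Metric compatibility expands the three derivative terms and vanishing torsion the three
  brackets; by symmetry of \<open>g\<close> everything cancels except two copies of the left-hand
  product.\<close>

lemma koszul:
  assumes lc: "levi_civita_on S g nabla" and p: "p \<in> S"
    and add: "\<And>v v' w. g p (v - v') w = g p v w - g p v' w" and sym: "\<And>v w. g p v w = g p w v"
    and X: "smooth_on S X" and Y: "smooth_on S Y" and Z: "smooth_on S Z"
  shows "2 * g p (nabla X Y p) (Z p) =
    dir_deriv X (\<lambda>q. g q (Y q) (Z q)) p + dir_deriv Y (\<lambda>q. g q (X q) (Z q)) p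
    - dir_deriv Z (\<lambda>q. g q (X q) (Y q)) p
    + g p (lie_bracket X Y p) (Z p) - g p (lie_bracket Y Z p) (X p) - g p (lie_bracket X Z p) (Y p)"
proof -
  have torsion: "g p (lie_bracket X Y p) (Z p) = g p (nabla X Y p) (Z p) - g p (nabla Y X p) (Z p)"
    if "smooth_on S X" "smooth_on S Y" for X Y Z :: vector_field
    using lc that p add unfolding levi_civita_on_def by metis
  have metric: "dir_deriv X (\<lambda>q. g q (Y q) (Z q)) p =
      g p (nabla X Y p) (Z p) + g p (Y p) (nabla X Z p)"
    if "smooth_on S X" "smooth_on S Y" "smooth_on S Z" for X Y Z
    using lc that p unfolding levi_civita_on_def by blast
  show ?thesis
    unfolding torsion[OF X Y] torsion[OF Y Z] torsion[OF X Z]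
      metric[OF X Y Z] metric[OF Y X Z] metric[OF Z X Y]
    using sym[of "X p"] sym[of "Y p"] by simp
qed

lemma lie_bracket_self [simp]: "lie_bracket X X p = 0"
  by (simp add: lie_bracket_def)

lemma diag_metric_add_left: "diag_metric f1 f2 p (v + v') w = diag_metric f1 f2 p v w + diag_metric f1 f2 p v' w"
  by (simp add: diag_metric_def algebra_simps)

lemma diag_metric_diff_left: "diag_metric f1 f2 p (v - v') w = diag_metric f1 f2 p v w - diag_metric f1 f2 p v' w"
  by (simp add: diag_metric_def algebra_simps)

lemma diag_metric_minus_left: "diag_metric f1 f2 p (- v) w = - diag_metric f1 f2 p v w"
  by (simp add: diag_metric_def algebra_simps)

lemma diag_metric_scale_left: "diag_metric f1 f2 p (c *\<^sub>R v) w = c * diag_metric f1 f2 p v w"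
  by (simp add: diag_metric_def algebra_simps)

lemma diag_metric_zero_left: "diag_metric f1 f2 p 0 w = 0"
  by (simp add: diag_metric_def)

lemma diag_metric_commute: "diag_metric f1 f2 p v w = diag_metric f1 f2 p w v"
  by (simp add: diag_metric_def algebra_simps)

lemmas diag_metric_left = diag_metric_add_left diag_metric_diff_left diag_metric_minus_left
  diag_metric_scale_left diag_metric_zero_left

section \<open>The orthonormal frame, its brackets and its connection\<close>

text \<open>The geometry is local, so \<open>S\<close> is any open set here; convexity and segments
  enter only when the final equations are integrated.\<close>

locale layered_diag_metric =
  fixes S :: "(real^3) set" and f1 f2 :: scalar_field and nabla :: covariant_derivative
  assumes open_S: "open S"
    and smooth_f: "smooth_on S f1" "smooth_on S f2"
    and f_nz: "\<And>p. p \<in> S \<Longrightarrow> f1 p \<noteq> 0" "\<And>p. p \<in> S \<Longrightarrow> f2 p \<noteq> 0"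
    and f1_dep: "depends_only_on_coord S 2 f1"
    and f2_dep: "depends_only_on_coord S 3 f2"
    and lc: "levi_civita_on S (diag_metric f1 f2) nabla"
begin

abbreviation "E \<equiv> diag_frame f1 f2"
abbreviation "g \<equiv> diag_metric f1 f2"

text \<open>Written with \<open>inverse\<close> instead of a quotient, so that
  \<open>smooth_mult\<close> and \<open>smooth_inverse\<close> apply directly; likewise for
  \<open>b\<close>.\<close>

definition a :: scalar_field where
  "a p = f2 p * frechet_derivative f1 (at p) (axis 2 1) * inverse (f1 p)"

definition b :: scalar_field where
  "b p = frechet_derivative f2 (at p) (axis 3 1) * inverse (f2 p)"

lemma smooth_ab: "smooth_on S a" "smooth_on S b"
  unfolding a_def b_def
  by (intro smooth_mult smooth_inverse smooth_deriv open_S smooth_f f_nz; assumption)+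

lemma f_diff: "p \<in> S \<Longrightarrow> f1 differentiable at p" "p \<in> S \<Longrightarrow> f2 differentiable at p"
  using smooth_f smooth_differentiable by blast+

lemma smooth_frame: "smooth_on S (E k)"
proof -
  have "smooth_on S (\<lambda>p. f1 p *\<^sub>R axis 1 (1::real) :: real^3)"
    "smooth_on S (\<lambda>p. f2 p *\<^sub>R axis 2 (1::real) :: real^3)"
    by (intro smooth_scaleR open_S smooth_f smooth_const)+
  then show ?thesis
    unfolding diag_frame_def[abs_def] coord_field_def
    by (cases "k = 1"; cases "k = 2") (auto simp: smooth_const)
qed

text \<open>Each frame field is a function times a constant vector, and the function has a single
  nonzero partial derivative, expressed here through \<open>a\<close> or \<open>b\<close>.\<close>

lemma frame_derivative:
  assumes "p \<in> S"
  shows "frechet_derivative (E k) (at p) v =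
    (if k = 1 then (v $ 2 * a p * f1 p / f2 p) *\<^sub>R axis 1 1
     else if k = 2 then (v $ 3 * b p * f2 p) *\<^sub>R axis 2 1 else 0)"
proof -
  have D: "frechet_derivative f1 (at p) v = v $ 2 * a p * f1 p / f2 p"
     "frechet_derivative f2 (at p) v = v $ 3 * b p * f2 p"
    using frechet_derivative_depends_only_on_coord[OF open_S assms f_diff(1)[OF assms] f1_dep, of v]
      frechet_derivative_depends_only_on_coord[OF open_S assms f_diff(2)[OF assms] f2_dep, of v]
      f_nz assms by (simp_all add: a_def b_def)
  have "frechet_derivative (\<lambda>p. f p *\<^sub>R c) (at p) v = frechet_derivative f (at p) v *\<^sub>R c"
    if "f differentiable at p" for f :: scalar_field and c :: "real^3"
    by (subst frechet_derivative_at[OF has_derivative_scaleR_left, symmetric, of f])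
      (use that in \<open>auto simp: frechet_derivative_works\<close>)
  then show ?thesis
    unfolding diag_frame_def[abs_def] coord_field_def
    using f_diff[OF assms] D by (cases "k = 1"; cases "k = 2") auto
qed

text \<open>Zero fields are written \<open>0 *\<^sub>R E 1 p\<close> here and below to match the premises of \<open>curvature_frame\<close>.\<close>

lemma frame_bracket:
  assumes "p \<in> S"
  shows "lie_bracket (E 1) (E 2) p = (- a p) *\<^sub>R E 1 p"
    "lie_bracket (E 1) (E 3) p = 0 *\<^sub>R E 1 p"
    "lie_bracket (E 2) (E 3) p = (- b p) *\<^sub>R E 2 p"
    "lie_bracket (E 2) (E 1) p = a p *\<^sub>R E 1 p"
    "lie_bracket (E 3) (E 1) p = 0 *\<^sub>R E 1 p"
    "lie_bracket (E 3) (E 2) p = b p *\<^sub>R E 2 p"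
  using f_nz[OF assms] assms
  by (simp_all add: lie_bracket_def frame_derivative)
   (simp_all add: diag_frame_def coord_field_def axis_def vec_eq_iff)

text \<open>This recovers a vector from its products with the frame, which is all that the Koszul
  formula determines.\<close>

lemma frame_expand:
  assumes "p \<in> S"
  shows "v = (\<Sum>k\<in>UNIV. g p v (E k p) *\<^sub>R E k p)"
  using f_nz[OF assms]
  by (simp add: sum_3 vec_eq_iff forall_3 diag_metric_def diag_frame_def coord_field_def axis_def
      power2_eq_square)

lemma frame_orthonormal: "p \<in> S \<Longrightarrow> g p (E i p) (E j p) = (if i = j then 1 else 0)"
  using f_nz diag_frame_orthonormal by blast

text \<open>Orthonormality makes these products constant on the open set \<open>S\<close>. Hence the
  derivative terms of the Koszul formula vanish on the frame.\<close>

lemma dir_deriv_frame_metric: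
  assumes "p \<in> S"
  shows "dir_deriv X (\<lambda>q. g q (E i q) (E j q)) p = 0"
proof -
  have "frechet_derivative (\<lambda>q. g q (E i q) (E j q)) (at p) =
      frechet_derivative (\<lambda>q. if i = j then 1 else 0) (at p)"
    by (rule fd_cong[OF open_S assms]) (simp add: frame_orthonormal)
  then show ?thesis by (simp add: dir_deriv_def)
qed

lemmas koszul_diag = koszul[where g = "diag_metric f1 f2", OF lc _ diag_metric_diff_left diag_metric_commute]

text \<open>On an orthonormal frame the Koszul formula involves only brackets, so
  \<open>frame_bracket\<close> yields every component of the connection.\<close>

lemma nabla_frame:
  assumes p: "p \<in> S"
  shows "nabla (E 1) (E 1) p = a p *\<^sub>R E 2 p"
    "nabla (E 1) (E 2) p = (- a p) *\<^sub>R E 1 p"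
    "nabla (E 1) (E 3) p = 0 *\<^sub>R E 1 p"
    "nabla (E 2) (E 1) p = 0 *\<^sub>R E 1 p"
    "nabla (E 2) (E 2) p = b p *\<^sub>R E 3 p"
    "nabla (E 2) (E 3) p = (- b p) *\<^sub>R E 2 p"
    "nabla (E 3) (E 1) p = 0 *\<^sub>R E 1 p"
    "nabla (E 3) (E 2) p = 0 *\<^sub>R E 1 p"
    "nabla (E 3) (E 3) p = 0 *\<^sub>R E 1 p"
proof -
  have *: "g p (nabla (E i) (E j) p) (E k p) = (g p (lie_bracket (E i) (E j) p) (E k p)
      - g p (lie_bracket (E j) (E k) p) (E i p) - g p (lie_bracket (E i) (E k) p) (E j p)) / 2" for i j k
    using koszul_diag[OF p smooth_frame[of i] smooth_frame[of j] smooth_frame[of k]]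
    by (simp add: dir_deriv_frame_metric p)
  note [simp] = sum_3 * frame_bracket p diag_metric_left frame_orthonormal
  show "nabla (E 1) (E 1) p = a p *\<^sub>R E 2 p" by (subst frame_expand[OF p]) simp
  show "nabla (E 1) (E 2) p = (- a p) *\<^sub>R E 1 p" by (subst frame_expand[OF p]) simp
  show "nabla (E 1) (E 3) p = 0 *\<^sub>R E 1 p" by (subst frame_expand[OF p]) simp
  show "nabla (E 2) (E 1) p = 0 *\<^sub>R E 1 p" by (subst frame_expand[OF p]) simp
  show "nabla (E 2) (E 2) p = b p *\<^sub>R E 3 p" by (subst frame_expand[OF p]) simp
  show "nabla (E 2) (E 3) p = (- b p) *\<^sub>R E 2 p" by (subst frame_expand[OF p]) simp
  show "nabla (E 3) (E 1) p = 0 *\<^sub>R E 1 p" by (subst frame_expand[OF p]) simp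
  show "nabla (E 3) (E 2) p = 0 *\<^sub>R E 1 p" by (subst frame_expand[OF p]) simp
  show "nabla (E 3) (E 3) p = 0 *\<^sub>R E 1 p" by (subst frame_expand[OF p]) simp
qed

text \<open>
  The connection axioms only speak about fields that are smooth on \<open>S\<close>; that \<open>nabla\<close> does not
  see values off \<open>S\<close> has to be extracted from the Koszul formula.
\<close>

lemma nabla_cong:
  assumes p: "p \<in> S" and sm: "smooth_on S X" "smooth_on S Y"
    and eq: "\<And>q. q \<in> S \<Longrightarrow> X q = X' q" "\<And>q. q \<in> S \<Longrightarrow> Y q = Y' q"
  shows "nabla X Y p = nabla X' Y' p"
proof -
  have sm': "smooth_on S X'" "smooth_on S Y'"
    using smooth_cong[OF open_S _ sm(1), of X'] smooth_cong[OF open_S _ sm(2), of Y'] eq by auto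
  have D: "frechet_derivative X (at p) = frechet_derivative X' (at p)"
    "frechet_derivative Y (at p) = frechet_derivative Y' (at p)"
    by (rule fd_cong[OF open_S p], erule eq)+
  have M: "frechet_derivative (\<lambda>q. g q (X q) (E k q)) (at p) = frechet_derivative (\<lambda>q. g q (X' q) (E k q)) (at p)"
    "frechet_derivative (\<lambda>q. g q (Y q) (E k q)) (at p) = frechet_derivative (\<lambda>q. g q (Y' q) (E k q)) (at p)"
    "frechet_derivative (\<lambda>q. g q (X q) (Y q)) (at p) = frechet_derivative (\<lambda>q. g q (X' q) (Y' q)) (at p)"
    for k by (rule fd_cong[OF open_S p], simp add: eq)+
  have "2 * g p (nabla X Y p) (E k p) = 2 * g p (nabla X' Y' p) (E k p)" for k
    unfolding koszul_diag[OF p sm smooth_frame] koszul_diag[OF p sm' smooth_frame]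
    by (simp add: dir_deriv_def lie_bracket_def D M eq p)
  then show ?thesis
    using frame_expand[OF p, of "nabla X Y p"] frame_expand[OF p, of "nabla X' Y' p"] by simp
qed

section \<open>Curvature and Ricci tensor on the frame\<close>

lemma nabla_scale_left:
  assumes "p \<in> S" "smooth_on S h" "smooth_on S X" "smooth_on S Y"
  shows "nabla (\<lambda>q. h q *\<^sub>R X q) Y p = h p *\<^sub>R nabla X Y p"
  using lc assms unfolding levi_civita_on_def affine_connection_on_def by blast

lemma nabla_scale_right:
  assumes "p \<in> S" "smooth_on S h" "smooth_on S X" "smooth_on S Y"
  shows "nabla X (\<lambda>q. h q *\<^sub>R Y q) p = dir_deriv X h p *\<^sub>R Y p + h p *\<^sub>R nabla X Y p"
  using lc assms unfolding levi_civita_on_def affine_connection_on_def by blast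

text \<open>All covariant derivatives and brackets of frame fields are function multiples of single
  frame fields, so the Leibniz rule and linearity over functions reduce curvature to
  \<open>nabla\<close> on the frame.\<close>

lemma curvature_frame:
  assumes p: "p \<in> S"
    and h: "smooth_on S h1" "smooth_on S h2" "smooth_on S h3"
    and eq: "\<And>q. q \<in> S \<Longrightarrow> nabla (E j) (E k) q = h1 q *\<^sub>R E l1 q"
      "\<And>q. q \<in> S \<Longrightarrow> nabla (E i) (E k) q = h2 q *\<^sub>R E l2 q"
      "\<And>q. q \<in> S \<Longrightarrow> lie_bracket (E i) (E j) q = h3 q *\<^sub>R E l3 q"
  shows "curvature nabla (E i) (E j) (E k) p =
    dir_deriv (E i) h1 p *\<^sub>R E l1 p + h1 p *\<^sub>R nabla (E i) (E l1) p
    - (dir_deriv (E j) h2 p *\<^sub>R E l2 p + h2 p *\<^sub>R nabla (E j) (E l2) p)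
    - h3 p *\<^sub>R nabla (E l3) (E k) p"
proof -
  note sc = smooth_scaleR[OF open_S _ smooth_frame]
  \<comment> \<open>\<open>nabla_cong\<close> is used reversed because smoothness is immediate for
    the explicit multiples.\<close>
  have "nabla (E i) (nabla (E j) (E k)) p = nabla (E i) (\<lambda>q. h1 q *\<^sub>R E l1 q) p"
    "nabla (E j) (nabla (E i) (E k)) p = nabla (E j) (\<lambda>q. h2 q *\<^sub>R E l2 q) p"
    "nabla (lie_bracket (E i) (E j)) (E k) p = nabla (\<lambda>q. h3 q *\<^sub>R E l3 q) (E k) p"
    by (rule nabla_cong[OF p, symmetric]; (intro sc smooth_frame h)?; simp add: eq)+
  then show ?thesis
    unfolding curvature_def by (simp add: nabla_scale_left nabla_scale_right p h smooth_frame)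
qed

text \<open>This disposes of the summand of the Ricci trace whose frame index is that of the first
  argument. Writing the zero bracket as a zero multiple of \<open>E 1\<close> makes linearity over
  functions applicable.\<close>

lemma curvature_frame_self:
  assumes p: "p \<in> S" and Z: "smooth_on S Z"
  shows "curvature nabla (E i) (E i) Z p = 0"
proof -
  have "lie_bracket (E i) (E i) = (\<lambda>q. 0 *\<^sub>R E 1 q)" by (simp add: fun_eq_iff)
  moreover have "nabla (\<lambda>q. 0 *\<^sub>R E 1 q) Z p = 0 *\<^sub>R nabla (E 1) Z p"
    by (rule nabla_scale_left[OF p smooth_const smooth_frame Z])
  ultimately show ?thesis by (simp add: curvature_def)
qed

lemma dir_deriv_minus:
  assumes "p \<in> S" "smooth_on S h"
  shows "dir_deriv X (\<lambda>q. - h q) p = - dir_deriv X h p"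
  unfolding dir_deriv_def
  by (subst frechet_derivative_at[OF has_derivative_minus, symmetric])
    (use assms smooth_differentiable in \<open>auto simp: frechet_derivative_works\<close>)

lemma dir_deriv_const [simp]: "dir_deriv X (\<lambda>q. c) p = 0"
  by (simp add: dir_deriv_def)

lemma smooth_uminus_ab: "smooth_on S (\<lambda>q. - a q)" "smooth_on S (\<lambda>q. - b q)"
  using smooth_mult[OF open_S smooth_const[of S "-1"] smooth_ab(1)]
    smooth_mult[OF open_S smooth_const[of S "-1"] smooth_ab(2)] by simp_all

text \<open>In the trace only the \<open>E k\<close> coefficient of the curvature with first
  argument \<open>E k\<close> survives; terms such as the \<open>E 2\<close> part of
  \<open>c1\<close> are orthogonal to \<open>E k\<close> and drop out.\<close>

lemma ricci_frame:
  assumes p: "p \<in> S"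
  shows "ricci g nabla E (E 1) (E 1) p = dir_deriv (E 2) a p - (a p)\<^sup>2"
    "ricci g nabla E (E 2) (E 2) p =
      dir_deriv (E 2) a p - (a p)\<^sup>2 + dir_deriv (E 3) b p - (b p)\<^sup>2"
    "ricci g nabla E (E 3) (E 3) p = dir_deriv (E 3) b p - (b p)\<^sup>2"
    "ricci g nabla E (E 1) (E 2) p = 0"
    "ricci g nabla E (E 2) (E 3) p = a p * b p"
proof -
  note sm = smooth_ab smooth_uminus_ab smooth_const
  note simps = p smooth_ab nabla_frame dir_deriv_minus power2_eq_square algebra_simps
  \<comment> \<open>In \<open>c0\<close> to \<open>c9\<close>, the last three facts given to
    \<open>curvature_frame\<close> are, in order, the two inner covariant derivatives and the
    bracket.\<close>
  have c0: "curvature nabla (E 2) (E 1) (E 1) p =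
      (dir_deriv (E 2) a p - (a p)\<^sup>2) *\<^sub>R E 2 p + (a p * b p) *\<^sub>R E 3 p"
    by (subst curvature_frame[OF p _ _ _ nabla_frame(1) nabla_frame(4) frame_bracket(4)];
        (rule sm | assumption | simp add: simps))
  have c1: "curvature nabla (E 3) (E 1) (E 1) p =
      dir_deriv (E 3) a p *\<^sub>R E 2 p"
    by (subst curvature_frame[OF p _ _ _ nabla_frame(1) nabla_frame(7) frame_bracket(5)];
        (rule sm | assumption | simp add: simps))
  have c2: "curvature nabla (E 1) (E 2) (E 2) p =
      dir_deriv (E 1) b p *\<^sub>R E 3 p + (dir_deriv (E 2) a p - (a p)\<^sup>2) *\<^sub>R E 1 p"
    by (subst curvature_frame[OF p _ _ _ nabla_frame(5) nabla_frame(2) frame_bracket(1)];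
        (rule sm | assumption | simp add: simps))
  have c3: "curvature nabla (E 3) (E 2) (E 2) p =
      (dir_deriv (E 3) b p - (b p)\<^sup>2) *\<^sub>R E 3 p"
    by (subst curvature_frame[OF p _ _ _ nabla_frame(5) nabla_frame(8) frame_bracket(6)];
        (rule sm | assumption | simp add: simps))
  have c4: "curvature nabla (E 1) (E 3) (E 3) p = 0"
    by (subst curvature_frame[OF p _ _ _ nabla_frame(9) nabla_frame(3) frame_bracket(2)];
        (rule sm | assumption | simp add: simps))
  have c5: "curvature nabla (E 2) (E 3) (E 3) p =
      (dir_deriv (E 3) b p - (b p)\<^sup>2) *\<^sub>R E 2 p"
    by (subst curvature_frame[OF p _ _ _ nabla_frame(9) nabla_frame(6) frame_bracket(3)];
        (rule sm | assumption | simp add: simps))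
  have c6: "curvature nabla (E 2) (E 1) (E 2) p =
      ((a p)\<^sup>2 - dir_deriv (E 2) a p) *\<^sub>R E 1 p - dir_deriv (E 1) b p *\<^sub>R E 3 p"
    by (subst curvature_frame[OF p _ _ _ nabla_frame(2) nabla_frame(5) frame_bracket(4)];
        (rule sm | assumption | simp add: simps))
  have c7: "curvature nabla (E 3) (E 1) (E 2) p =
      (- dir_deriv (E 3) a p) *\<^sub>R E 1 p"
    by (subst curvature_frame[OF p _ _ _ nabla_frame(2) nabla_frame(8) frame_bracket(5)];
        (rule sm | assumption | simp add: simps))
  have c8: "curvature nabla (E 1) (E 2) (E 3) p =
      (a p * b p) *\<^sub>R E 1 p - dir_deriv (E 1) b p *\<^sub>R E 2 p"
    by (subst curvature_frame[OF p _ _ _ nabla_frame(6) nabla_frame(3) frame_bracket(1)];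
        (rule sm | assumption | simp add: simps))
  have c9: "curvature nabla (E 3) (E 2) (E 3) p =
      ((b p)\<^sup>2 - dir_deriv (E 3) b p) *\<^sub>R E 2 p"
    by (subst curvature_frame[OF p _ _ _ nabla_frame(6) nabla_frame(9) frame_bracket(6)];
        (rule sm | assumption | simp add: simps))
  note [simp] = ricci_def sum_3 c0 c1 c2 c3 c4 c5 c6 c7 c8 c9
    curvature_frame_self[OF p smooth_frame] diag_metric_left frame_orthonormal[OF p]
  show "ricci g nabla E (E 1) (E 1) p = dir_deriv (E 2) a p - (a p)\<^sup>2" by simp
  show "ricci g nabla E (E 2) (E 2) p = dir_deriv (E 2) a p - (a p)\<^sup>2 + dir_deriv (E 3) b p - (b p)\<^sup>2" by simp
  show "ricci g nabla E (E 3) (E 3) p = dir_deriv (E 3) b p - (b p)\<^sup>2" by simp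
  show "ricci g nabla E (E 1) (E 2) p = 0" by simp
  show "ricci g nabla E (E 2) (E 3) p = a p * b p" by simp
qed

section \<open>The soliton equation on the frame\<close>

text \<open>As \<open>V\<close> has zero derivative on \<open>S\<close>, the brackets cancel the
  terms that differentiate \<open>Y\<close> and \<open>Z\<close>. What remains is the x^3-derivative
  of the metric coefficients, and only that of \<open>f2\<close> can be nonzero.\<close>

lemma lie_derivative_coord_field:
  assumes p: "p \<in> S" and V: "\<And>q. q \<in> S \<Longrightarrow> V q = coord_field 3 q"
    and Y: "smooth_on S Y" and Z: "smooth_on S Z"
  shows "lie_derivative V g Y Z p = - 2 * b p / (f2 p)\<^sup>2 * (Y p $ 2 * Z p $ 2)"
proof -
  have "frechet_derivative V (at p) = frechet_derivative (\<lambda>q. axis 3 1) (at p)"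
    by (rule fd_cong[OF open_S p]) (simp add: V coord_field_def)
  then have DV: "frechet_derivative V (at p) v = 0" for v by simp
  let ?D = "\<lambda>f. frechet_derivative f (at p)"
  have der: "(f has_derivative ?D f) (at p)" if "smooth_on S f" for f :: "real^3 \<Rightarrow> 'b::real_normed_vector"
    using smooth_differentiable[OF that p] frechet_derivative_works by blast
  have D: "?D f1 (axis 3 1) = 0" "?D f2 (axis 3 1) = b p * f2 p"
    using f_nz p frechet_derivative_depends_only_on_coord[OF open_S p f_diff(1)[OF p] f1_dep, of "axis 3 1"]
    by (simp_all add: b_def axis_def)
  note nth = bounded_linear.has_derivative[OF bounded_linear_vec_nth]
  have summand: "((\<lambda>q. 1 / (u q)\<^sup>2 * (Y q $ k * Z q $ k)) has_derivative (\<lambda>v.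
      1 / (u p)\<^sup>2 * (Y p $ k * ?D Z v $ k + ?D Y v $ k * Z p $ k)
      + (- 2 * ?D u v / (u p)^3) * (Y p $ k * Z p $ k))) (at p)"
    if u: "smooth_on S u" "u p \<noteq> 0" for u k
  proof -
    have "((\<lambda>q. inverse (u q * u q)) has_derivative (\<lambda>v.
        - (inverse (u p * u p) * (u p * ?D u v + ?D u v * u p) * inverse (u p * u p)))) (at p)"
      using u by (intro Deriv.has_derivative_inverse has_derivative_mult der) simp_all
    also have "(\<lambda>v. - (inverse (u p * u p) * (u p * ?D u v + ?D u v * u p) * inverse (u p * u p))) =
        (\<lambda>v. - 2 * ?D u v / (u p)^3)"
      using u(2) by (simp add: fun_eq_iff field_simps power3_eq_cube)
    finally have "((\<lambda>q. 1 / (u q)\<^sup>2) has_derivative (\<lambda>v. - 2 * ?D u v / (u p)^3)) (at p)"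
      by (simp add: power2_eq_square divide_inverse)
    then show ?thesis by (intro has_derivative_mult nth der Y Z)
  qed
  \<comment> \<open>The third term of the metric has coefficient 1, so the plain product rule
    suffices for it.\<close>
  note has_derivative_add[OF has_derivative_add[OF summand[OF smooth_f(1) f_nz(1)[OF p], of 1]
        summand[OF smooth_f(2) f_nz(2)[OF p], of 2]]
      has_derivative_mult[OF nth[OF der[OF Y]] nth[OF der[OF Z]], of 3 3]]
  note frechet_derivative_at[OF this, folded diag_metric_def, symmetric]
  then show ?thesis
    using f_nz[OF p]
    by (simp add: lie_derivative_def dir_deriv_def lie_bracket_def DV V[OF p] coord_field_def D)
      (simp add: diag_metric_def field_simps power2_eq_square power3_eq_cube)
qed

text \<open>Testing on pairs of frame fields yields scalar equations. The pair (1,2) comes first: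
  Lie, Ricci and metric terms all vanish there, and \<open>f = 0\<close> then removes the last term
  from the other equations.\<close>

lemma soliton_equations:
  assumes sol: "almost_eta_ricci_soliton S g nabla E V \<eta> lam mu"
    and V: "\<And>q. q \<in> S \<Longrightarrow> V q = coord_field 3 q"
    and \<eta>: "\<And>q k. q \<in> S \<Longrightarrow> \<eta> q (E k q) = f q"
    and mu: "\<And>q. q \<in> S \<Longrightarrow> mu q \<noteq> 0"
    and p: "p \<in> S"
  shows "f p = 0" "b p = 0" "lam p = 0" "dir_deriv (E 2) a p = (a p)\<^sup>2"
proof -
  have eq: "- b q / (f2 q)\<^sup>2 * (E i q $ 2 * E j q $ 2) + ricci g nabla E (E i) (E j) q
      + lam q * (if i = j then 1 else 0) + mu q * (f q)\<^sup>2 = 0" if q: "q \<in> S" for i j q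
  proof -
    have "(1/2) * lie_derivative V g (E i) (E j) q + ricci g nabla E (E i) (E j) q
        + lam q * g q (E i q) (E j q) + mu q * (\<eta> q (E i q) * \<eta> q (E j q)) = 0"
      using sol q smooth_frame unfolding almost_eta_ricci_soliton_def by blast
    then show ?thesis
      by (simp add: lie_derivative_coord_field[OF q V smooth_frame smooth_frame]
          \<eta>[OF q] frame_orthonormal[OF q] power2_eq_square)
  qed
  have E2: "E 1 q $ 2 = 0" "E 2 q $ 2 = f2 q" "E 3 q $ 2 = 0" for q
    by (simp_all add: diag_frame_def coord_field_def axis_def)
  have f0: "f q = 0" if q: "q \<in> S" for q
    using eq[OF q, of 1 2] mu[OF q] by (simp add: E2 ricci_frame q)
  \<comment> \<open>Proved on all of \<open>S\<close>, since this identity is differentiated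
    below.\<close>
  have ab: "a q * b q = 0" if q: "q \<in> S" for q
    using eq[OF q, of 2 3] by (simp add: E2 ricci_frame q f0)
  have lam: "lam q = - b q" and ode: "dir_deriv (E 2) a q - (a q)\<^sup>2 = b q" if q: "q \<in> S" for q
    using eq[OF q, of 1 1] eq[OF q, of 2 2] eq[OF q, of 3 3] f_nz[OF q]
    by (simp_all add: E2 ricci_frame q f0 power2_eq_square)
  show b0: "b p = 0"
  proof (rule ccontr)
    assume "b p \<noteq> 0"
    then have a0: "a p = 0" using ab[OF p] by simp
    have der: "(h has_derivative frechet_derivative h (at p)) (at p)" if "smooth_on S h" for h :: scalar_field
      using smooth_differentiable[OF that p] frechet_derivative_works by blast
    have "((\<lambda>q. a q * b q) has_derivative
        (\<lambda>v. a p * frechet_derivative b (at p) v + frechet_derivative a (at p) v * b p)) (at p)"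
      by (intro has_derivative_mult der smooth_ab)
    moreover have "((\<lambda>q. a q * b q) has_derivative (\<lambda>v. 0)) (at p)"
      by (rule has_derivative_transform_within_open[OF _ open_S p, of "\<lambda>q. 0"]) (simp_all add: ab)
    ultimately have "(\<lambda>v. a p * frechet_derivative b (at p) v + frechet_derivative a (at p) v * b p) = (\<lambda>v. 0)"
      by (rule has_derivative_unique)
    then have "dir_deriv (E 2) a p = 0"
      using a0 \<open>b p \<noteq> 0\<close> by (simp add: dir_deriv_def fun_eq_iff)
    with ode[OF p] a0 \<open>b p \<noteq> 0\<close> show False by simp
  qed
  show "f p = 0" by (rule f0[OF p])
  show "lam p = 0" using lam[OF p] b0 by simp
  show "dir_deriv (E 2) a p = (a p)\<^sup>2" using ode[OF p] b0 by simp
qed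

section \<open>Integrating the equations for the two coefficients\<close>

text \<open>Vanishing \<open>b\<close> kills the only possible partial derivative of
  \<open>f2\<close>, and convexity turns zero derivative into constancy.\<close>

lemma f2_constant_on:
  assumes "convex S" and b0: "\<And>p. p \<in> S \<Longrightarrow> b p = 0"
  shows "f2 constant_on S"
proof -
  have "(f2 has_derivative (\<lambda>v. 0)) (at p within S)" if p: "p \<in> S" for p
  proof -
    have "frechet_derivative f2 (at p) (axis 3 1) = 0"
      using b0[OF p] f_nz[OF p] by (simp add: b_def)
    then have "frechet_derivative f2 (at p) = (\<lambda>v. 0)"
      using frechet_derivative_depends_only_on_coord[OF open_S p f_diff(2)[OF p] f2_dep]
      by (metis mult_zero_right)
    then show ?thesis
      using f_diff(2)[OF p] by (metis frechet_derivative_works has_derivative_at_withinI)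
  qed
  then show ?thesis
    using has_derivative_zero_constant[OF assms(1), of f2] unfolding constant_on_def by blast
qed

text \<open>With \<open>f2 = C\<close>, the derivatives along the line are
  \<open>f1' = a * f1 / C\<close> and \<open>a' = a\<^sup>2 / C\<close>. Thus the reciprocal of
  \<open>f1\<close> has derivative \<open>- a / (C * f1)\<close>, whose own derivative is zero by
  cancellation.\<close>

lemma inverse_f1_affine:
  assumes J: "convex J" and line: "\<And>t. t \<in> J \<Longrightarrow> p + t *\<^sub>R axis 2 1 \<in> S"
    and f2: "f2 constant_on S" and ode: "\<And>q. q \<in> S \<Longrightarrow> dir_deriv (E 2) a q = (a q)\<^sup>2"
  obtains c d where "\<And>t. t \<in> J \<Longrightarrow> inverse (f1 (p + t *\<^sub>R axis 2 1)) = c * t + d"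
proof -
  obtain C where C: "\<And>q. q \<in> S \<Longrightarrow> f2 q = C" using f2 unfolding constant_on_def by blast
  let ?\<gamma> = "\<lambda>t. p + t *\<^sub>R axis 2 (1::real)"
  have f1': "((\<lambda>t. f1 (?\<gamma> t)) has_real_derivative a (?\<gamma> t) * f1 (?\<gamma> t) / C) (at t)"
    and a': "((\<lambda>t. a (?\<gamma> t)) has_real_derivative (a (?\<gamma> t))\<^sup>2 / C) (at t)" if t: "t \<in> J" for t
  proof -
    note q = line[OF t]
    have "frechet_derivative f1 (at (?\<gamma> t)) (axis 2 1) = a (?\<gamma> t) * f1 (?\<gamma> t) / C"
      using f_nz[OF q] C[OF q] by (simp add: a_def)
    then show "((\<lambda>t. f1 (?\<gamma> t)) has_real_derivative a (?\<gamma> t) * f1 (?\<gamma> t) / C) (at t)"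
      using has_derivative_along_line[OF f_diff(1)[OF q]] by simp
    have da: "a differentiable at (?\<gamma> t)" by (rule smooth_differentiable[OF smooth_ab(1) q])
    have "frechet_derivative a (at (?\<gamma> t)) (axis 2 1) = (a (?\<gamma> t))\<^sup>2 / C"
      using ode[OF q] f_nz(2)[OF q] C[OF q] linear_cmul[OF linear_frechet_derivative[OF da]]
      by (simp add: dir_deriv_def diag_frame_def coord_field_def field_simps)
    then show "((\<lambda>t. a (?\<gamma> t)) has_real_derivative (a (?\<gamma> t))\<^sup>2 / C) (at t)"
      using has_derivative_along_line[OF da] by simp
  qed
  show thesis
  proof (rule affine_of_second_derivative_zero[OF J])
    fix t assume t: "t \<in> J"
    note nz = f_nz(1)[OF line[OF t]] f_nz(2)[OF line[OF t]]
    show "((\<lambda>t. inverse (f1 (?\<gamma> t))) has_real_derivative - a (?\<gamma> t) / (C * f1 (?\<gamma> t))) (at t)"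
      by (rule derivative_eq_intros f1'[OF t] refl)+ (use nz in \<open>auto simp: field_simps\<close>)
    show "((\<lambda>t. - a (?\<gamma> t) / (C * f1 (?\<gamma> t))) has_real_derivative 0) (at t)"
      by (rule derivative_eq_intros f1'[OF t] a'[OF t] refl)+
        (use nz C[OF line[OF t]] in \<open>auto simp: field_simps power2_eq_square\<close>)
  qed (rule that)
qed

end

section \<open>The box domain and the conclusion\<close>

lemma open_box3:
  assumes "open I1" "open I2" "open I3"
  shows "open (box3 I1 I2 I3)"
proof -
  have "box3 I1 I2 I3 = (\<lambda>p. p $ 1) -` I1 \<inter> (\<lambda>p. p $ 2) -` I2 \<inter> (\<lambda>p. p $ 3) -` I3"
    by (auto simp: box3_def)
  then show ?thesis
    using assms by (auto intro!: open_Int open_vimage continuous_intros)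
qed

lemma convex_box3: "convex I1 \<Longrightarrow> convex I2 \<Longrightarrow> convex I3 \<Longrightarrow> convex (box3 I1 I2 I3)"
  unfolding box3_def convex_def by simp

theorem proposition3p8:
  fixes I1 I2 I3 :: "real set"
    and f1 f2 lam mu f :: "real^3 \<Rightarrow> real"
    and nabla :: covariant_derivative
    and V :: vector_field
    and \<eta> :: covector_field
    and \<eta>c :: "3 \<Rightarrow> real^3 \<Rightarrow> real"
  defines "I \<equiv> box3 I1 I2 I3"
    and "g \<equiv> diag_metric f1 f2"
    and "E \<equiv> diag_frame f1 f2"
    and "e \<equiv> diag_coframe f1 f2"
  assumes "open_interval I1" "open_interval I2" "open_interval I3"
    and "smooth_on I f1" "smooth_on I f2"
    and "\<forall>p\<in>I. f1 p \<noteq> 0" "\<forall>p\<in>I. f2 p \<noteq> 0"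
    and "levi_civita_on I g nabla"
    and "almost_eta_ricci_soliton I g nabla E V \<eta> lam mu"
    and "\<forall>p\<in>I. V p = coord_field 3 p"
    and "depends_only_on_coord I 2 f1"
    and "depends_only_on_coord I 3 f2"
    and "\<forall>p\<in>I. \<forall>v. \<eta> p v = (\<Sum>k\<in>UNIV. \<eta>c k p * e k p v)"
    and "\<forall>p\<in>I. \<forall>k. \<eta>c k p = f p"
    and "\<forall>p\<in>I. mu p \<noteq> 0"
  shows "(\<forall>p\<in>I. \<forall>v. \<eta> p v = 0) \<and> (\<forall>p\<in>I. lam p = 0) \<and>
    killing_on I g V \<and>
    f2 constant_on I \<and>
    (f1 constant_on I \<or>
     (\<exists>c1 c2. c1 \<noteq> 0 \<and> c2 \<notin> I2 \<and> (\<forall>p\<in>I. f1 p = c1 / (p $ 2 - c2))))"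
proof -
  have op: "open I1" "open I2" "open I3" and cv: "convex I1" "convex I2" "convex I3"
    and ne: "I1 \<noteq> {}" "I2 \<noteq> {}" "I3 \<noteq> {}"
    using assms(5-7) by (auto simp: open_interval_def is_interval_convex)
  have f_nz: "\<And>p. p \<in> I \<Longrightarrow> f1 p \<noteq> 0" "\<And>p. p \<in> I \<Longrightarrow> f2 p \<noteq> 0"
    using assms(10,11) by auto
  interpret layered_diag_metric I f1 f2 nabla
    using assms open_box3[OF op] by unfold_locales auto
  have V: "\<And>q. q \<in> I \<Longrightarrow> V q = coord_field 3 q" using assms by blast
  \<comment> \<open>Duality of frame and coframe picks out the k-th component of \<eta>.\<close>
  have "\<eta> q (E k q) = f q" if q: "q \<in> I" for q k
  proof -
    have "\<eta> q (E k q) = (\<Sum>j\<in>UNIV. \<eta>c j q * e j q (E k q))" using assms q by blast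
    also have "\<dots> = (\<Sum>j\<in>UNIV. f q * (if j = k then 1 else 0))"
      using assms q f_nz[OF q] by (simp add: diag_coframe_dual)
    finally show ?thesis by (simp flip: sum_distrib_left)
  qed
  note eqs = soliton_equations[OF assms(13)[unfolded g_def E_def] V this[unfolded E_def]]
  have f0: "f p = 0" and b0: "b p = 0" and lam: "lam p = 0"
    and ode: "dir_deriv (diag_frame f1 f2 2) a p = (a p)\<^sup>2" if "p \<in> I" for p
    using eqs that assms(19) by blast+
  have "\<forall>p\<in>I. \<forall>v. \<eta> p v = 0" using assms f0 by simp
  moreover have "killing_on I g V"
    using assms(13) lie_derivative_coord_field[OF _ V] b0
    by (simp add: killing_on_def almost_eta_ricci_soliton_def g_def)
  moreover have f2c: "f2 constant_on I"
    using f2_constant_on[OF _ b0] convex_box3[OF cv] by (simp add: I_def)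
  moreover have "f1 constant_on I \<or>
     (\<exists>c1 c2. c1 \<noteq> 0 \<and> c2 \<notin> I2 \<and> (\<forall>p\<in>I. f1 p = c1 / (p $ 2 - c2)))"
  proof -
    obtain x1 x3 where x: "x1 \<in> I1" "x3 \<in> I3" using ne by blast
    \<comment> \<open>The middle entry 0 makes the line parameter equal to the coordinate x^2;
      \<open>p0\<close> itself may lie outside \<open>I\<close>.\<close>
    define p0 :: "real^3" where "p0 = vector [x1, 0, x3]"
    let ?\<gamma> = "\<lambda>t. p0 + t *\<^sub>R axis 2 (1::real)"
    have \<gamma>: "?\<gamma> t \<in> I" "?\<gamma> t $ 2 = t" if "t \<in> I2" for t
      using x that by (simp_all add: I_def box3_def p0_def axis_def)
    obtain c d where cd: "\<And>t. t \<in> I2 \<Longrightarrow> inverse (f1 (?\<gamma> t)) = c * t + d"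
      using inverse_f1_affine[OF cv(2) \<gamma>(1) f2c ode] by blast
    have mem: "p $ 2 \<in> I2" if "p \<in> I" for p
      using that by (simp add: I_def box3_def)
    \<comment> \<open>One line suffices, since \<open>f1\<close> takes the same value at
      \<open>p\<close> and at the line point sharing its second coordinate.\<close>
    have f1: "f1 p = inverse (c * p $ 2 + d)" if p: "p \<in> I" for p
    proof -
      have "f1 p = f1 (?\<gamma> (p $ 2))"
        using f1_dep p \<gamma>[OF mem[OF p]] unfolding depends_only_on_coord_def by metis
      then show ?thesis using cd[OF mem[OF p]] by (metis inverse_inverse_eq)
    qed
    show ?thesis
    proof (cases "c = 0")
      case True
      then have "f1 constant_on I" unfolding constant_on_def using f1 by auto
      then show ?thesis ..
    next
      case False
      \<comment> \<open>This zero of the affine function would be a zero of the reciprocal of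
        \<open>f1\<close>. It serves as \<open>c2\<close>, with \<open>1 / c\<close> as
        \<open>c1\<close>.\<close>
      have "- d / c \<notin> I2"
      proof
        assume "- d / c \<in> I2"
        then have "inverse (f1 (?\<gamma> (- d / c))) = 0"
          using cd[OF \<open>- d / c \<in> I2\<close>] False by simp
        then show False using f_nz(1) \<gamma>(1)[OF \<open>- d / c \<in> I2\<close>] by simp
      qed
      moreover have "f1 p = (1 / c) / (p $ 2 - (- d / c))" if "p \<in> I" for p
        using f1[OF that] False by (simp add: field_simps)
      ultimately show ?thesis using False by (intro disjI2 exI[of _ "1 / c"] exI[of _ "- d / c"]) auto
    qed
  qed
  ultimately show ?thesis using lam by blast
qed

end
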